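(* Let $\mathcal F$ be a marked set over a weakly noetherian reduction structure $\mathcal J=(M,\lambda,\tau)$. Let $\mathcal J'=(M,\lambda,\tau')$ be a noetherian substructure of $\mathcal J$ and let $\overline\tau=\{\overline\tau_\alpha\}_{x^\alpha\in M}$ be a family of sets of terms with $\overline\tau_\alpha\subseteq\tau'_\alpha$ such that the sets $x^\alpha\overline\tau_\alpha$ ($x^\alpha\in M$) are pairwise disjoint with union $J$. The following statements are equivalent: (i) $\rightarrow^+_{\mathcal F\mathcal J}$ is confluent. (ii) $\langle\tau\mathcal F\rangle\oplus\langle\mathsf N(J)\rangle=\mathcal P$. (iii) $\langle\tau\mathcal F\rangle\cap\langle\mathsf N(J)\rangle=0$. (iv) $\langle\tau\mathcal F\rangle=\langle\tau'\mathcal F\rangle=\langle\overline\tau\mathcal F\rangle$. (v) For each $x^\eta f_\alpha\in\tau\mathcal F\setminus\overline\tau\mathcal F$ it holds $x^\eta f_\alpha\rightarrow^+_{\overline\tau\mathcal F\mathcal J}0\downarrow$. (vi) For each $x^\eta f_\alpha\in\tau\mathcal F$ and each reduction $x^\eta f_\alpha\rightarrow^+_{\mathcal F\mathcal J'}l\downarrow$ it holds $l=0$. (vii) For each $x^\eta f_\alpha\in\tau\mathcal F$ and $x^{\eta'}f_{\alpha'}\in\tau'\mathcal F$ with $x^{\eta+\alpha}=x^{\eta'+\alpha'}$ it holds $x^\eta f_\alpha-x^{\eta'}f_{\alpha'}\rightarrow^+_{\mathcal F\mathcal J'}0\downarrow$. (viii) For each $x^\eta f_\alpha\in\tau\mathcal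 F$ and each reduction $x^\eta f_\alpha\rightarrow^+_{\mathcal F\mathcal J}l\downarrow$ it holds $l=0$. (ix) For each $x^\eta f_\alpha,x^{\eta'}f_{\alpha'}\in\tau\mathcal F$ with $x^{\eta+\alpha}=x^{\eta'+\alpha'}$ and each reduction $x^\eta f_\alpha-x^{\eta'}f_{\alpha'}\rightarrow^+_{\mathcal F\mathcal J}l\downarrow$ it holds $l=0$.
   Context: Let $A$ be a field, $\mathcal P=A[x_1,\dots,x_n]$, and $\mathcal T$ the set of terms $x^\alpha=x_1^{\alpha_1}\cdots x_n^{\alpha_n}$, $\alpha\in\mathbb N^n$. $\operatorname{Supp}(g)\subset\mathcal T$ is the set of terms with nonzero coefficient in $g$; $\langle V\rangle$ is the $A$-span of $V\subset\mathcal P$. A semigroup ideal is a subset of $\mathcal T$ closed under multiplication by terms; an order ideal is the complement in $\mathcal T$ of a semigroup ideal. A reduction structure (RS) is a triple $\mathcal J=(M,\lambda=\{\lambda_\alpha\}_{x^\alpha\in M},\tau=\{\tau_\alpha\}_{x^\alpha\in M})$ where $M\subset\mathcal T$ is finite, $J$ denotes the semigroup ideal generated by $M$, each $\tau_\alpha\subseteq\mathcal T$ is an order ideal, $\operatorname{cone}(x^\alpha)=\{x^{\alpha+\eta}: x^\eta\in\tau_\alpha\}$, $\bigcup_{x^\alpha\in M}\operatorname{cone}(x^\alpha)=J$, and $\lambda_\alpha\subseteq\mathcal T\setminus\operatorname{cone}(x^\alpha)$. $\mathsf N(J)=\mathcal T\setminus J$. All RSs are assumed to have finite tails: every $\lambda_\alpha$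 is finite. A substructure of $\mathcal J$ is an RS $(M,\lambda,\tau')$ with $\tau'_\alpha\subseteq\tau_\alpha$ for all $x^\alpha\in M$. A marked set over $\mathcal J$ is a set $\mathcal F=\{f_\alpha\}_{x^\alpha\in M}\subset\mathcal P$ such that $x^\alpha$ has coefficient $1$ in $f_\alpha$ and $\operatorname{Supp}(f_\alpha-x^\alpha)\subset\lambda_\alpha$. For a family $\sigma=\{\sigma_\alpha\}_{x^\alpha\in M}$ of subsets of $\mathcal T$ put $\sigma\mathcal F=\{x^\eta f_\alpha: x^\alpha\in M,\ x^\eta\in\sigma_\alpha\}$ (used for $\tau,\tau',\overline\tau$). One-step reduction: $g\rightarrow_{\mathcal F\mathcal J}h$ if there are $x^\gamma\in\operatorname{Supp}(g)$ with coefficient $c$ in $g$, $x^\alpha\in M$ and $x^\eta\in\tau_\alpha$ with $x^\gamma=x^{\alpha+\eta}$ and $h=g-cx^\eta f_\alpha$. $\rightarrow^+_{\mathcal F\mathcal J}$ is the reflexive-transitive closure. $\rightarrow^+_{\mathcal F\mathcal J'}$ is defined in the same way with $\tau'$ in place of $\tau$, and $\rightarrow^+_{\overline\tau\mathcal F\mathcal J}$ with $\overline\tau$ in place of $\tau$. For any of these relations, $g\rightarrow^+l\downarrow$ means $g\rightarrow^+l$ and $\operatorname{Supp}(l)\subset\mathsf N(J)$. An RS is noetherian if for every marked set over it there is no infinite chain of one-step reductions; it is weakly noetherian if it has a noetherian substructure. $\rightarrow^+_{\mathcal F\mathcal J}$ is confluent if for each $g\in\mathcal P$ there is one and only one $l$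 with $g\rightarrow^+_{\mathcal F\mathcal J}l\downarrow$. *)

theory Defs
  imports Complex_Main "HOL-Library.Poly_Mapping" "HOL-Library.Disjoint_Sets"
begin

text \<open>
  The variables are indexed by the finite type \<open>'n\<close>. A term is represented by its exponent, so the
  product of terms is addition of exponents. A polynomial maps exponents to coefficients;
  \<open>Poly_Mapping.keys g\<close> is its support and \<open>Poly_Mapping.lookup g t\<close> the coefficient of \<open>t\<close>. Families
  indexed by a set \<open>M\<close> of terms are total functions, of which only the values on \<open>M\<close> are used.
\<close>

type_synonym 'n trm = "'n \<Rightarrow>\<^sub>0 nat"
type_synonym ('n, 'a) polyn = "'n trm \<Rightarrow>\<^sub>0 'a"

definition monomial :: "'n::finite trm \<Rightarrow> ('n, 'a::field) polyn" where
  "monomial t = Poly_Mapping.single t 1"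

definition poly_scale :: "'a::field \<Rightarrow> ('n::finite, 'a) polyn \<Rightarrow> ('n, 'a) polyn" where
  "poly_scale c p = Poly_Mapping.single 0 c * p"

global_interpretation polyn: vector_space poly_scale
  defines lin_span = polyn.span
  by unfold_locales
    (simp_all add: poly_scale_def algebra_simps single_add mult_single flip: mult.assoc)

definition direct_sum_is_all :: "('n::finite, 'a::field) polyn set \<Rightarrow> ('n, 'a) polyn set \<Rightarrow> bool" where
  "direct_sum_is_all U W \<longleftrightarrow> (\<forall>p. \<exists>u\<in>U. \<exists>w\<in>W. p = u + w) \<and> U \<inter> W = {0}"

definition semigroup_ideal :: "'n::finite trm set \<Rightarrow> bool" where
  "semigroup_ideal I \<longleftrightarrow> (\<forall>s\<in>I. \<forall>t. s + t \<in> I)"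

definition order_ideal :: "'n::finite trm set \<Rightarrow> bool" where
  "order_ideal D \<longleftrightarrow> (\<exists>I. semigroup_ideal I \<and> D = - I)"

definition gen_ideal :: "'n::finite trm set \<Rightarrow> 'n trm set" where
  "gen_ideal M = semigroup_ideal hull M"

definition normal_terms :: "'n::finite trm set \<Rightarrow> 'n trm set" where
  "normal_terms M = - gen_ideal M"

definition cone :: "('n::finite trm \<Rightarrow> 'n trm set) \<Rightarrow> 'n trm \<Rightarrow> 'n trm set" where
  "cone \<tau> \<alpha> = {\<alpha> + \<eta> | \<eta>. \<eta> \<in> \<tau> \<alpha>}"

text \<open>Finiteness of the tails is part of the definition.\<close>

definition reduction_structure ::
  "'n::finite trm set \<Rightarrow> ('n trm \<Rightarrow> 'n trm set) \<Rightarrow> ('n trm \<Rightarrow> 'n trm set) \<Rightarrow> bool" where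
  "reduction_structure M \<Lambda> \<tau> \<longleftrightarrow>
     finite M \<and>
     (\<forall>\<alpha>\<in>M. order_ideal (\<tau> \<alpha>)) \<and>
     (\<Union>\<alpha>\<in>M. cone \<tau> \<alpha>) = gen_ideal M \<and>
     (\<forall>\<alpha>\<in>M. \<Lambda> \<alpha> \<subseteq> - cone \<tau> \<alpha>) \<and>
     (\<forall>\<alpha>\<in>M. finite (\<Lambda> \<alpha>))"

text \<open>\<open>substructure M \<Lambda> \<tau>' \<tau>\<close>: the triple with \<open>\<tau>'\<close> is a substructure of the one with \<open>\<tau>\<close>.\<close>

definition substructure ::
  "'n::finite trm set \<Rightarrow> ('n trm \<Rightarrow> 'n trm set) \<Rightarrow> ('n trm \<Rightarrow> 'n trm set) \<Rightarrow> ('n trm \<Rightarrow> 'n trm set) \<Rightarrow> bool"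
  where
  "substructure M \<Lambda> \<tau>' \<tau> \<longleftrightarrow> reduction_structure M \<Lambda> \<tau>' \<and> (\<forall>\<alpha>\<in>M. \<tau>' \<alpha> \<subseteq> \<tau> \<alpha>)"

definition marked_set ::
  "'n::finite trm set \<Rightarrow> ('n trm \<Rightarrow> 'n trm set) \<Rightarrow> ('n trm \<Rightarrow> ('n, 'a::field) polyn) \<Rightarrow> bool" where
  "marked_set M \<Lambda> f \<longleftrightarrow>
     (\<forall>\<alpha>\<in>M. Poly_Mapping.lookup (f \<alpha>) \<alpha> = 1 \<and> Poly_Mapping.keys (f \<alpha> - monomial \<alpha>) \<subseteq> \<Lambda> \<alpha>)"

definition term_multiples ::
  "'n::finite trm set \<Rightarrow> ('n trm \<Rightarrow> 'n trm set) \<Rightarrow> ('n trm \<Rightarrow> ('n, 'a::field) polyn) \<Rightarrow> ('n, 'a) polyn set"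
  where
  "term_multiples M \<sigma> f = {monomial \<eta> * f \<alpha> | \<alpha> \<eta>. \<alpha> \<in> M \<and> \<eta> \<in> \<sigma> \<alpha>}"

definition red_step ::
  "'n::finite trm set \<Rightarrow> ('n trm \<Rightarrow> 'n trm set) \<Rightarrow> ('n trm \<Rightarrow> ('n, 'a::field) polyn) \<Rightarrow>
   ('n, 'a) polyn \<Rightarrow> ('n, 'a) polyn \<Rightarrow> bool" where
  "red_step M \<sigma> f g h \<longleftrightarrow>
     (\<exists>\<gamma>\<in>Poly_Mapping.keys g. \<exists>\<alpha>\<in>M. \<exists>\<eta>\<in>\<sigma> \<alpha>.
        \<gamma> = \<alpha> + \<eta> \<and> h = g - poly_scale (Poly_Mapping.lookup g \<gamma>) (monomial \<eta> * f \<alpha>))"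

text \<open>\<open>reduces_down M \<sigma> f g l\<close> is $g \rightarrow^+ l\downarrow$.\<close>

definition reduces_down ::
  "'n::finite trm set \<Rightarrow> ('n trm \<Rightarrow> 'n trm set) \<Rightarrow> ('n trm \<Rightarrow> ('n, 'a::field) polyn) \<Rightarrow>
   ('n, 'a) polyn \<Rightarrow> ('n, 'a) polyn \<Rightarrow> bool" where
  "reduces_down M \<sigma> f g l \<longleftrightarrow>
     (red_step M \<sigma> f)\<^sup>*\<^sup>* g l \<and> Poly_Mapping.keys l \<subseteq> normal_terms M"

text \<open>Noetherianity quantifies over the marked sets with coefficients in the given field, hence the
  type argument.\<close>

definition noetherian ::
  "'a::field itself \<Rightarrow> 'n::finite trm set \<Rightarrow> ('n trm \<Rightarrow> 'n trm set) \<Rightarrow> ('n trm \<Rightarrow> 'n trm set) \<Rightarrow> bool" where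
  "noetherian _ M \<Lambda> \<tau> \<longleftrightarrow>
     (\<forall>f :: 'n trm \<Rightarrow> ('n, 'a) polyn. marked_set M \<Lambda> f \<longrightarrow>
        (\<nexists>g :: nat \<Rightarrow> ('n, 'a) polyn. \<forall>k. red_step M \<tau> f (g k) (g (Suc k))))"

definition weakly_noetherian ::
  "'a::field itself \<Rightarrow> 'n::finite trm set \<Rightarrow> ('n trm \<Rightarrow> 'n trm set) \<Rightarrow> ('n trm \<Rightarrow> 'n trm set) \<Rightarrow> bool" where
  "weakly_noetherian TA M \<Lambda> \<tau> \<longleftrightarrow> (\<exists>\<tau>'. substructure M \<Lambda> \<tau>' \<tau> \<and> noetherian TA M \<Lambda> \<tau>')"

definition confluent ::
  "'n::finite trm set \<Rightarrow> ('n trm \<Rightarrow> 'n trm set) \<Rightarrow> ('n trm \<Rightarrow> ('n, 'a::field) polyn) \<Rightarrow> bool" where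
  "confluent M \<tau> f \<longleftrightarrow> (\<forall>g. \<exists>!l. reduces_down M \<tau> f g l)"

definition all_equivalent :: "bool list \<Rightarrow> bool" where
  "all_equivalent Ps \<longleftrightarrow> (\<forall>P\<in>set Ps. \<forall>Q\<in>set Ps. P \<longleftrightarrow> Q)"

end

theory Submission
  imports Defs "HOL-Library.Confluence"
begin

text \<open>
  The proof needs no term order. A reduction structure enters only through its rules
  \<open>(\<gamma>, b)\<close>, where \<open>b = x\<^sup>\<eta> f\<^sub>\<alpha>\<close> has coefficient 1 at its head
  \<open>\<gamma> = \<alpha> + \<eta>\<close>, and a step subtracts from \<open>g\<close> the multiple of \<open>b\<close> that kills the coefficient of
  \<open>g\<close> at \<open>\<gamma>\<close>. As the result depends linearly on \<open>g\<close>, a reduction of a difference \<open>p - q\<close> lifts to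
  reductions of \<open>p\<close> and \<open>q\<close> (\<open>steps_of_difference\<close>), and adding a multiple of \<open>b\<close> to \<open>g\<close> gives a
  polynomial that is joinable with \<open>g\<close> (\<open>joinable_add_rule\<close>). This links rewriting with linear
  algebra: if normal forms exist and are unique, then the span of the rules meets the normal
  polynomials only in 0 (\<open>normal_in_span_eq_0\<close>).

  For terminating rules, unique normal forms come from Newman's lemma
  (\<open>unique_normal_forms_if_critical_pairs\<close>). Two steps at distinct heads \<open>\<gamma> \<noteq> \<delta>\<close> commute up to
  further steps unless each of the two rules contains the head of the other, and then reducing
  the two heads in turn would never stop (\<open>no_mutual_heads\<close>). So only pairs of rules with the same
  head matter, and for these it suffices that the difference reduces to 0. Since noetherianity
  passes from \<open>\<tau>'\<close> to \<open>\<tau>bar\<close>, this applies twice: for \<open>\<tau>bar\<close>, where each head has just one rule, and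
  for \<open>\<tau>'\<close> if (vii) holds.

  Hence every polynomial is the sum of an element of \<open>\<langle>\<tau>bar F\<rangle>\<close> and its normal form, and this sum
  is direct. Therefore (iii) says that \<open>\<langle>\<tau>F\<rangle>\<close> is no larger than \<open>\<langle>\<tau>bar F\<rangle>\<close>, which is (iv), and
  the other statements follow along
  (iii) \<open>\<Rightarrow>\<close> (viii) \<open>\<Rightarrow>\<close> (vi) \<open>\<Rightarrow>\<close> (v) \<open>\<Rightarrow>\<close> (iv) \<open>\<Rightarrow>\<close> (iii),
  (iii) \<open>\<Rightarrow>\<close> (ix) \<open>\<Rightarrow>\<close> (vii) \<open>\<Rightarrow>\<close> (iii), (i) \<open>\<Leftrightarrow>\<close> (iii) and (ii) \<open>\<Leftrightarrow>\<close> (iii).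
\<close>

section \<open>Preliminaries on rewriting and on polynomials\<close>

text \<open>
  The classical argument: the two first steps are joined by local confluence, and the induction
  hypothesis closes the diagram on either side.
\<close>

lemma newman:
  assumes wf: "wfp (r\<inverse>\<inverse>)"
    and loc: "\<And>x y z. r x y \<Longrightarrow> r x z \<Longrightarrow> \<exists>u. r\<^sup>*\<^sup>* y u \<and> r\<^sup>*\<^sup>* z u"
  shows "confluentp r"
proof (rule confluentpI)
  fix x y z
  assume "r\<^sup>*\<^sup>* x y" "r\<^sup>*\<^sup>* x z"
  with wf show "\<exists>u. r\<^sup>*\<^sup>* y u \<and> r\<^sup>*\<^sup>* z u"
  proof (induction x arbitrary: y z rule: wfp_induct_rule)
    case (less x)
    show ?case
    proof (cases "x = y \<or> x = z")
      case True
      with less.prems show ?thesis by blast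
    next
      case False
      from less.prems(1) False obtain y1 where y1: "r x y1" "r\<^sup>*\<^sup>* y1 y"
        by (cases rule: converse_rtranclpE) auto
      from less.prems(2) False obtain z1 where z1: "r x z1" "r\<^sup>*\<^sup>* z1 z"
        by (cases rule: converse_rtranclpE) auto
      from loc[OF y1(1) z1(1)] obtain u where u: "r\<^sup>*\<^sup>* y1 u" "r\<^sup>*\<^sup>* z1 u" by blast
      from less.IH[of y1 y u] y1 u obtain v where v: "r\<^sup>*\<^sup>* y v" "r\<^sup>*\<^sup>* u v" by auto
      have "r\<^sup>*\<^sup>* z1 v" using u(2) v(2) by (rule rtranclp_trans)
      with less.IH[of z1 z v] z1 obtain w where "r\<^sup>*\<^sup>* z w" "r\<^sup>*\<^sup>* v w" by auto
      with v(1) show ?thesis by (meson rtranclp_trans)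
    qed
  qed
qed

lemma lookup_single_times:
  fixes g :: "'b::cancel_comm_monoid_add \<Rightarrow>\<^sub>0 'c::comm_semiring_0"
  shows "Poly_Mapping.lookup (Poly_Mapping.single s c * g) (s + t) = c * Poly_Mapping.lookup g t"
  by (simp add: lookup_mult lookup_single when_mult)

lemma lookup_poly_scale [simp]:
  "Poly_Mapping.lookup (poly_scale c p) t = c * Poly_Mapping.lookup p t"
  unfolding poly_scale_def by (metis add_0 lookup_single_times)

lemma lin_span_monomials:
  "lin_span (monomial ` S) = {p :: ('n::finite, 'a::field) polyn. Poly_Mapping.keys p \<subseteq> S}"
proof (intro equalityI subsetI; unfold mem_Collect_eq)
  fix p :: "('n, 'a) polyn"
  assume "p \<in> lin_span (monomial ` S)"
  then show "Poly_Mapping.keys p \<subseteq> S"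
  proof (induction p rule: polyn.span_induct_alt)
    case (step c x y)
    then show ?case
      by (auto simp: in_keys_iff lookup_add monomial_def lookup_single when_def split: if_splits)
  qed simp
next
  fix p :: "('n, 'a) polyn"
  assume keys: "Poly_Mapping.keys p \<subseteq> S"
  have "p = (\<Sum>t\<in>Poly_Mapping.keys p. poly_scale (Poly_Mapping.lookup p t) (monomial t))"
    by (rule poly_mapping_eqI)
      (simp add: lookup_sum monomial_def lookup_single when_def if_distrib in_keys_iff cong: if_cong)
  also have "\<dots> \<in> lin_span (monomial ` S)"
    using keys by (intro polyn.span_sum polyn.span_scale polyn.span_base) auto
  finally show "p \<in> lin_span (monomial ` S)" .
qed

section \<open>Rewriting by monic rules\<close>

text \<open>
  Only the coefficient of a rule at its head is constrained: other rules may share the head, and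
  reduction need not terminate. This covers the families \<open>\<tau>\<close>, \<open>\<tau>'\<close> and \<open>\<tau>bar\<close> alike.
\<close>

locale monic_rules =
  fixes R :: "('n::finite trm \<times> ('n, 'a::field) polyn) set"
  assumes monic: "(\<gamma>, b) \<in> R \<Longrightarrow> Poly_Mapping.lookup b \<gamma> = 1"
begin

definition step :: "('n, 'a) polyn \<Rightarrow> ('n, 'a) polyn \<Rightarrow> bool" where
  "step g h \<longleftrightarrow>
     (\<exists>(\<gamma>, b)\<in>R. \<gamma> \<in> Poly_Mapping.keys g \<and> h = g - poly_scale (Poly_Mapping.lookup g \<gamma>) b)"

definition normal :: "('n, 'a) polyn \<Rightarrow> bool" where
  "normal g \<longleftrightarrow> Poly_Mapping.keys g \<subseteq> - fst ` R"

definition unique_normal_forms :: bool where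
  "unique_normal_forms \<longleftrightarrow> (\<forall>g. \<exists>!l. step\<^sup>*\<^sup>* g l \<and> normal l)"

definition joinable :: "('n, 'a) polyn \<Rightarrow> ('n, 'a) polyn \<Rightarrow> bool" where
  "joinable p q \<longleftrightarrow> (\<exists>u. step\<^sup>*\<^sup>* p u \<and> step\<^sup>*\<^sup>* q u)"

lemma normal_iff_irreducible: "normal g \<longleftrightarrow> (\<nexists>h. step g h)"
  by (force simp: normal_def step_def)

lemma normal_steps_eq: "step\<^sup>*\<^sup>* g h \<Longrightarrow> normal g \<Longrightarrow> h = g"
  by (erule converse_rtranclpE) (auto simp: normal_iff_irreducible)

lemma steps_diff_in_span: "step\<^sup>*\<^sup>* g h \<Longrightarrow> g - h \<in> lin_span (snd ` R)"
proof (induction rule: rtranclp_induct)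
  case base
  show ?case by (simp add: polyn.span_zero)
next
  case (step y z)
  from step.hyps(2) obtain \<gamma> b where b: "(\<gamma>, b) \<in> R"
    and z: "z = y - poly_scale (Poly_Mapping.lookup y \<gamma>) b"
    by (auto simp: step_def)
  have "g - z = (g - y) + poly_scale (Poly_Mapping.lookup y \<gamma>) b"
    by (simp add: z)
  moreover have "poly_scale (Poly_Mapping.lookup y \<gamma>) b \<in> lin_span (snd ` R)"
    using b by (intro polyn.span_scale polyn.span_base) force
  ultimately show ?case using polyn.span_add[OF step.IH] by metis
qed

text \<open>
  Subtracting with the current coefficient is always allowed: if the head does not occur, nothing
  is subtracted and no step is made. This spares case distinctions on cancelling coefficients.
\<close>

lemma steps_eliminate:
  "(\<gamma>, b) \<in> R \<Longrightarrow> step\<^sup>*\<^sup>* g (g - poly_scale (Poly_Mapping.lookup g \<gamma>) b)"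
proof (cases "\<gamma> \<in> Poly_Mapping.keys g")
  case False
  then show ?thesis by (simp add: in_keys_iff)
qed (force simp: step_def)

text \<open>
  Eliminating the head \<open>\<gamma>\<close> by \<open>b\<close> projects along \<open>b\<close>, so it forgets any multiple of \<open>b\<close>.
\<close>

lemma joinable_add_rule:
  assumes "(\<gamma>, b) \<in> R"
  shows "joinable g (poly_scale c b + g)"
proof -
  let ?u = "g - poly_scale (Poly_Mapping.lookup g \<gamma>) b"
  have "step\<^sup>*\<^sup>* (poly_scale c b + g)
    (poly_scale c b + g - poly_scale (Poly_Mapping.lookup (poly_scale c b + g) \<gamma>) b)"
    using assms by (rule steps_eliminate)
  also have "poly_scale c b + g - poly_scale (Poly_Mapping.lookup (poly_scale c b + g) \<gamma>) b = ?u"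
    using monic[OF assms] by (simp add: lookup_add polyn.scale_left_distrib)
  finally show ?thesis
    unfolding joinable_def using steps_eliminate[OF assms, of g] by blast
qed

text \<open>
  Elimination of a fixed head by a fixed rule is linear. A step on the difference is imitated by
  the same elimination on both sides, which may be empty on one of them.
\<close>

lemma steps_of_difference:
  assumes "step\<^sup>*\<^sup>* (p - q) h"
  shows "\<exists>p' q'. step\<^sup>*\<^sup>* p p' \<and> step\<^sup>*\<^sup>* q q' \<and> p' - q' = h"
  using assms
proof (induction rule: rtranclp_induct)
  case base
  show ?case by blast
next
  case (step y z)
  from step.IH obtain p' q' where pq: "step\<^sup>*\<^sup>* p p'" "step\<^sup>*\<^sup>* q q'" "p' - q' = y" by blast
  from step.hyps(2) obtain \<gamma> b where b: "(\<gamma>, b) \<in> R"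
    and z: "z = y - poly_scale (Poly_Mapping.lookup y \<gamma>) b"
    by (auto simp: step_def)
  have "(p' - poly_scale (Poly_Mapping.lookup p' \<gamma>) b)
      - (q' - poly_scale (Poly_Mapping.lookup q' \<gamma>) b) = z"
    using z pq(3) by (auto simp: lookup_minus polyn.scale_left_diff_distrib)
  moreover have "step\<^sup>*\<^sup>* p (p' - poly_scale (Poly_Mapping.lookup p' \<gamma>) b)"
    using pq(1) steps_eliminate[OF b] by (rule rtranclp_trans)
  moreover have "step\<^sup>*\<^sup>* q (q' - poly_scale (Poly_Mapping.lookup q' \<gamma>) b)"
    using pq(2) steps_eliminate[OF b] by (rule rtranclp_trans)
  ultimately show ?case by blast
qed

lemma steps_scale:
  assumes "step\<^sup>*\<^sup>* g h"
  shows "step\<^sup>*\<^sup>* (poly_scale c g) (poly_scale c h)"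
  using assms
proof (induction rule: rtranclp_induct)
  case (step y z)
  from step.hyps(2) obtain \<gamma> b where b: "(\<gamma>, b) \<in> R"
    and z: "z = y - poly_scale (Poly_Mapping.lookup y \<gamma>) b"
    by (auto simp: step_def)
  have "poly_scale c z
      = poly_scale c y - poly_scale (Poly_Mapping.lookup (poly_scale c y) \<gamma>) b"
    by (simp add: z polyn.scale_right_diff_distrib)
  with step.IH steps_eliminate[OF b, of "poly_scale c y"] show ?case
    by (metis rtranclp_trans)
qed simp

text \<open>
  The normal form does not change when a multiple of a rule is added, hence it does not change
  when an element of the span is added. So every element of the span has the normal form 0.
  In the step from (i) to (iii) this is applied to \<open>\<tau>\<close>, whose reductions may run forever.
\<close>

lemma normal_in_span_eq_0:
  assumes uniq: unique_normal_forms
    and n: "n \<in> lin_span (snd ` R)" "normal n"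
  shows "n = 0"
proof -
  define nf where "nf g = (THE l. step\<^sup>*\<^sup>* g l \<and> normal l)" for g
  have nf: "step\<^sup>*\<^sup>* g (nf g) \<and> normal (nf g)" for g
    unfolding nf_def by (rule theI') (use uniq in \<open>simp add: unique_normal_forms_def\<close>)
  have nf_eq: "nf g = l" if "step\<^sup>*\<^sup>* g l" "normal l" for g l
    using uniq nf[of g] that by (auto simp: unique_normal_forms_def)
  have "nf g = nf h" if "step\<^sup>*\<^sup>* g h" for g h
    using nf_eq[of g "nf h"] nf[of h] that by (meson rtranclp_trans)
  then have nf_joinable: "nf p = nf q" if "joinable p q" for p q
    using that unfolding joinable_def by metis
  from n(1) have "nf n = nf 0"
  proof (induction n rule: polyn.span_induct_alt)
    case (step c x y)
    then obtain \<gamma> where "(\<gamma>, x) \<in> R" by auto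
    from nf_joinable[OF joinable_add_rule[OF this]] step.IH show ?case by simp
  qed simp
  moreover have "nf n = n" using n(2) by (intro nf_eq) auto
  moreover have "nf 0 = 0" by (intro nf_eq) (auto simp: normal_def)
  ultimately show ?thesis by simp
qed

lemma normal_form_exists:
  assumes "wfp (step\<inverse>\<inverse>)"
  shows "\<exists>l. step\<^sup>*\<^sup>* g l \<and> normal l"
  using assms
proof (induction g rule: wfp_induct_rule)
  case (less g)
  show ?case
  proof (cases "normal g")
    case False
    then obtain h where "step g h" by (auto simp: normal_iff_irreducible)
    with less[of h] show ?thesis by (auto intro: converse_rtranclp_into_rtranclp)
  qed blast
qed

text \<open>
  A polynomial in which exactly one of \<open>\<gamma>\<close>, \<open>\<delta>\<close> occurs could be reduced at that term. If both
  coefficients were nonzero, the result would again contain exactly one of the two terms, whatever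
  happens elsewhere. This loop contradicts termination for every field: over a finite field too, no
  cancellation can break it.
\<close>

lemma no_mutual_heads:
  assumes wf: "wfp (step\<inverse>\<inverse>)"
    and b: "(\<gamma>, b) \<in> R" and d: "(\<delta>, d) \<in> R" and neq: "\<gamma> \<noteq> \<delta>"
  shows "Poly_Mapping.lookup b \<delta> = 0 \<or> Poly_Mapping.lookup d \<gamma> = 0"
proof (rule ccontr)
  assume nz: "\<not> ?thesis"
  define A where "A = {g :: ('n, 'a) polyn.
    (Poly_Mapping.lookup g \<gamma> \<noteq> 0) \<noteq> (Poly_Mapping.lookup g \<delta> \<noteq> 0)}"
  have "monomial \<gamma> \<in> A"
    using neq by (simp add: A_def monomial_def lookup_single when_def)
  then obtain g where g: "g \<in> A" and min: "\<And>h. step g h \<Longrightarrow> h \<notin> A"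
    using wf unfolding wfp_eq_minimal by (metis conversep.simps)
  show False
  proof (cases "Poly_Mapping.lookup g \<gamma> = 0")
    case False
    then have "step g (g - poly_scale (Poly_Mapping.lookup g \<gamma>) b)"
      using b by (auto simp: step_def in_keys_iff)
    from min[OF this] False g nz monic[OF b] show False
      by (auto simp: A_def lookup_minus)
  next
    case True
    then have "step g (g - poly_scale (Poly_Mapping.lookup g \<delta>) d)"
      using d g by (auto simp: step_def in_keys_iff A_def)
    from min[OF this] True g nz monic[OF d] show False
      by (auto simp: A_def lookup_minus)
  qed
qed

text \<open>
  When \<open>d\<close> does not contain \<open>\<gamma>\<close>, eliminating \<open>\<delta>\<close> leaves the coefficient at \<open>\<gamma>\<close> intact, whereas
  eliminating \<open>\<gamma>\<close> may change the one at \<open>\<delta>\<close>. The common reduct eliminates \<open>\<gamma>\<close> and then \<open>\<delta>\<close>; the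
  other order gets there by one more elimination of \<open>\<delta>\<close>.
\<close>

lemma joinable_distinct_heads:
  assumes b: "(\<gamma>, b) \<in> R" and d: "(\<delta>, d) \<in> R"
    and zero: "Poly_Mapping.lookup d \<gamma> = 0"
  shows "joinable (g - poly_scale (Poly_Mapping.lookup g \<gamma>) b)
                  (g - poly_scale (Poly_Mapping.lookup g \<delta>) d)"
proof -
  define x where "x = Poly_Mapping.lookup g \<gamma>"
  define y where "y = Poly_Mapping.lookup g \<delta>"
  define \<beta> where "\<beta> = Poly_Mapping.lookup b \<delta>"
  define u where "u = g - poly_scale x b - poly_scale (y - x * \<beta>) d"
  have "step\<^sup>*\<^sup>* (g - poly_scale x b) u"
    using steps_eliminate[OF d, of "g - poly_scale x b"]
    by (simp add: u_def lookup_minus y_def \<beta>_def)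
  moreover have "step\<^sup>*\<^sup>* (g - poly_scale y d) (g - poly_scale y d - poly_scale x b)"
    using steps_eliminate[OF b, of "g - poly_scale y d"] zero
    by (simp add: lookup_minus x_def)
  moreover have "step\<^sup>*\<^sup>* (g - poly_scale y d - poly_scale x b) u"
  proof -
    have "Poly_Mapping.lookup (g - poly_scale y d - poly_scale x b) \<delta> = - x * \<beta>"
      using monic[OF d] by (simp add: lookup_minus y_def \<beta>_def)
    moreover have "g - poly_scale y d - poly_scale x b - poly_scale (- x * \<beta>) d = u"
      by (simp add: u_def polyn.scale_left_diff_distrib polyn.scale_minus_left)
    ultimately show ?thesis
      using steps_eliminate[OF d, of "g - poly_scale y d - poly_scale x b"] by simp
  qed
  ultimately show ?thesis
    unfolding joinable_def x_def[symmetric] y_def[symmetric] by (meson rtranclp_trans)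
qed

text \<open>
  For equal heads the two results differ by a multiple of the difference of the rules, which
  reduces to 0, and the lifting to both sides joins them. For distinct heads one of the
  two rules does not contain the other head.
\<close>

lemma unique_normal_forms_if_critical_pairs:
  assumes wf: "wfp (step\<inverse>\<inverse>)"
    and crit: "\<And>\<gamma> b b'. (\<gamma>, b) \<in> R \<Longrightarrow> (\<gamma>, b') \<in> R \<Longrightarrow> step\<^sup>*\<^sup>* (b' - b) 0"
  shows unique_normal_forms
proof -
  have local_confluence: "joinable y z" if yz: "step x y" "step x z" for x y z
  proof -
    from yz obtain \<gamma> b \<delta> d where b: "(\<gamma>, b) \<in> R" and d: "(\<delta>, d) \<in> R"
      and y: "y = x - poly_scale (Poly_Mapping.lookup x \<gamma>) b"
      and z: "z = x - poly_scale (Poly_Mapping.lookup x \<delta>) d"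
      by (auto simp: step_def)
    show ?thesis
    proof (cases "\<gamma> = \<delta>")
      case True
      have "y - z = poly_scale (Poly_Mapping.lookup x \<gamma>) (d - b)"
        by (simp add: y z True polyn.scale_right_diff_distrib)
      then have "step\<^sup>*\<^sup>* (y - z) 0"
        using steps_scale[OF crit[OF b, of d], of "Poly_Mapping.lookup x \<gamma>"] d True by simp
      then show ?thesis
        using steps_of_difference[of y z 0] by (auto simp: joinable_def)
    next
      case False
      from no_mutual_heads[OF wf b d False] show ?thesis
      proof
        assume "Poly_Mapping.lookup d \<gamma> = 0"
        with joinable_distinct_heads[OF b d] show ?thesis by (simp add: y z)
      next
        assume "Poly_Mapping.lookup b \<delta> = 0"
        with joinable_distinct_heads[OF d b] show ?thesis by (auto simp: y z joinable_def)
      qed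
    qed
  qed
  have confl: "confluentp step"
    using wf local_confluence by (intro newman) (auto simp: joinable_def)
  have "l = l'" if "step\<^sup>*\<^sup>* g l \<and> normal l" "step\<^sup>*\<^sup>* g l' \<and> normal l'" for g l l'
    using confluentpD[OF confl, of g l l'] that normal_steps_eq by metis
  then show ?thesis
    unfolding unique_normal_forms_def using normal_form_exists[OF wf] by blast
qed

end

section \<open>The rules of a reduction structure\<close>

definition head_rules ::
  "'n::finite trm set \<Rightarrow> ('n trm \<Rightarrow> 'n trm set) \<Rightarrow> ('n trm \<Rightarrow> ('n, 'a::field) polyn) \<Rightarrow>
   ('n trm \<times> ('n, 'a) polyn) set" where
  "head_rules M \<sigma> f = {(\<alpha> + \<eta>, monomial \<eta> * f \<alpha>) | \<alpha> \<eta>. \<alpha> \<in> M \<and> \<eta> \<in> \<sigma> \<alpha>}"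

lemma monic_head_rules:
  assumes "marked_set M \<Lambda> f"
  shows "monic_rules (head_rules M \<sigma> f)"
proof
  fix \<gamma> b
  assume "(\<gamma>, b) \<in> head_rules M \<sigma> f"
  then obtain \<alpha> \<eta> where "\<alpha> \<in> M" and "\<gamma> = \<eta> + \<alpha>" and "b = monomial \<eta> * f \<alpha>"
    by (auto simp: head_rules_def add.commute)
  with assms show "Poly_Mapping.lookup b \<gamma> = 1"
    by (simp add: monomial_def lookup_single_times marked_set_def)
qed

lemma snd_head_rules: "snd ` head_rules M \<sigma> f = term_multiples M \<sigma> f"
  by (force simp: head_rules_def term_multiples_def)

lemma fst_head_rules: "fst ` head_rules M \<sigma> f = (\<Union>\<alpha>\<in>M. cone \<sigma> \<alpha>)"
  by (force simp: head_rules_def cone_def)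

lemma step_head_rules:
  assumes "marked_set M \<Lambda> f"
  shows "monic_rules.step (head_rules M \<sigma> f) = red_step M \<sigma> f"
proof (intro ext)
  fix g h
  show "monic_rules.step (head_rules M \<sigma> f) g h = red_step M \<sigma> f g h"
    unfolding monic_rules.step_def[OF monic_head_rules[OF assms]]
  proof
    assume "\<exists>(\<gamma>, b)\<in>head_rules M \<sigma> f.
      \<gamma> \<in> Poly_Mapping.keys g \<and> h = g - poly_scale (Poly_Mapping.lookup g \<gamma>) b"
    then obtain \<alpha> \<eta> where "\<alpha> \<in> M" "\<eta> \<in> \<sigma> \<alpha>" "\<alpha> + \<eta> \<in> Poly_Mapping.keys g"
      and "h = g - poly_scale (Poly_Mapping.lookup g (\<alpha> + \<eta>)) (monomial \<eta> * f \<alpha>)"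
      by (auto simp: head_rules_def)
    then show "red_step M \<sigma> f g h"
      unfolding red_step_def by blast
  next
    assume "red_step M \<sigma> f g h"
    then obtain \<alpha> \<eta> where "\<alpha> \<in> M" "\<eta> \<in> \<sigma> \<alpha>" "\<alpha> + \<eta> \<in> Poly_Mapping.keys g"
      and h: "h = g - poly_scale (Poly_Mapping.lookup g (\<alpha> + \<eta>)) (monomial \<eta> * f \<alpha>)"
      unfolding red_step_def by blast
    then have "(\<alpha> + \<eta>, monomial \<eta> * f \<alpha>) \<in> head_rules M \<sigma> f"
      by (auto simp: head_rules_def)
    then show "\<exists>(\<gamma>, b)\<in>head_rules M \<sigma> f.
      \<gamma> \<in> Poly_Mapping.keys g \<and> h = g - poly_scale (Poly_Mapping.lookup g \<gamma>) b"
      using \<open>\<alpha> + \<eta> \<in> Poly_Mapping.keys g\<close> h by (intro bexI) auto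
  qed
qed

lemma reduces_down_head_rules:
  assumes "marked_set M \<Lambda> f" and "(\<Union>\<alpha>\<in>M. cone \<sigma> \<alpha>) = gen_ideal M"
  shows "reduces_down M \<sigma> f g l \<longleftrightarrow>
    (monic_rules.step (head_rules M \<sigma> f))\<^sup>*\<^sup>* g l \<and> monic_rules.normal (head_rules M \<sigma> f) l"
  by (simp add: reduces_down_def step_head_rules[OF assms(1)] fst_head_rules assms(2)
      monic_rules.normal_def[OF monic_head_rules[OF assms(1)]] normal_terms_def)

lemma red_step_mono:
  assumes "\<And>\<alpha>. \<alpha> \<in> M \<Longrightarrow> \<sigma> \<alpha> \<subseteq> \<rho> \<alpha>"
  shows "red_step M \<sigma> f \<le> red_step M \<rho> f"
  unfolding red_step_def using assms by blast

lemma reduces_down_mono: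
  assumes "\<And>\<alpha>. \<alpha> \<in> M \<Longrightarrow> \<sigma> \<alpha> \<subseteq> \<rho> \<alpha>" and "reduces_down M \<sigma> f g l"
  shows "reduces_down M \<rho> f g l"
  using assms(2) rtranclp_mono[OF red_step_mono[of M \<sigma> \<rho> f, OF assms(1)]]
  by (auto simp: reduces_down_def)

lemma term_multiples_mono:
  assumes "\<And>\<alpha>. \<alpha> \<in> M \<Longrightarrow> \<sigma> \<alpha> \<subseteq> \<rho> \<alpha>"
  shows "term_multiples M \<sigma> f \<subseteq> term_multiples M \<rho> f"
  using assms by (fastforce simp: term_multiples_def)

lemma noetherian_imp_wfp:
  fixes f :: "'n::finite trm \<Rightarrow> ('n, 'a::field) polyn"
  assumes "noetherian TYPE('a) M \<Lambda> \<tau>" and "marked_set M \<Lambda> f"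
  shows "wfp ((red_step M \<tau> f)\<inverse>\<inverse>)"
proof -
  have "\<nexists>g. \<forall>k. red_step M \<tau> f (g k) (g (Suc k))"
    using assms unfolding noetherian_def by blast
  then show ?thesis
    unfolding wfp_def wf_iff_no_infinite_down_chain by simp
qed

section \<open>The equivalences\<close>

theorem theorem7p6:
  fixes M :: "'n::finite trm set"
    and \<Lambda> \<tau> \<tau>' \<tau>bar :: "'n trm \<Rightarrow> 'n trm set"
    and f :: "'n trm \<Rightarrow> ('n, 'a::field) polyn"
  assumes "reduction_structure M \<Lambda> \<tau>"
    and "weakly_noetherian TYPE('a) M \<Lambda> \<tau>"
    and "marked_set M \<Lambda> f"
    and "substructure M \<Lambda> \<tau>' \<tau>"
    and "noetherian TYPE('a) M \<Lambda> \<tau>'"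
    and "\<And>\<alpha>. \<alpha> \<in> M \<Longrightarrow> \<tau>bar \<alpha> \<subseteq> \<tau>' \<alpha>"
    and "disjoint_family_on (cone \<tau>bar) M"
    and "(\<Union>\<alpha>\<in>M. cone \<tau>bar \<alpha>) = gen_ideal M"
  shows "all_equivalent
    [confluent M \<tau> f,
     direct_sum_is_all (lin_span (term_multiples M \<tau> f)) (lin_span (monomial ` normal_terms M)),
     lin_span (term_multiples M \<tau> f) \<inter> lin_span (monomial ` normal_terms M) = {0},
     lin_span (term_multiples M \<tau> f) = lin_span (term_multiples M \<tau>' f) \<and>
       lin_span (term_multiples M \<tau>' f) = lin_span (term_multiples M \<tau>bar f),
     \<forall>p \<in> term_multiples M \<tau> f - term_multiples M \<tau>bar f. reduces_down M \<tau>bar f p 0,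
     \<forall>p \<in> term_multiples M \<tau> f. \<forall>l. reduces_down M \<tau>' f p l \<longrightarrow> l = 0,
     \<forall>\<alpha>\<in>M. \<forall>\<eta>\<in>\<tau> \<alpha>. \<forall>\<alpha>'\<in>M. \<forall>\<eta>'\<in>\<tau>' \<alpha>'. \<eta> + \<alpha> = \<eta>' + \<alpha>' \<longrightarrow>
       reduces_down M \<tau>' f (monomial \<eta> * f \<alpha> - monomial \<eta>' * f \<alpha>') 0,
     \<forall>p \<in> term_multiples M \<tau> f. \<forall>l. reduces_down M \<tau> f p l \<longrightarrow> l = 0,
     \<forall>\<alpha>\<in>M. \<forall>\<eta>\<in>\<tau> \<alpha>. \<forall>\<alpha>'\<in>M. \<forall>\<eta>'\<in>\<tau> \<alpha>'. \<eta> + \<alpha> = \<eta>' + \<alpha>' \<longrightarrow>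
       (\<forall>l. reduces_down M \<tau> f (monomial \<eta> * f \<alpha> - monomial \<eta>' * f \<alpha>') l \<longrightarrow> l = 0)]"
    (is "all_equivalent [?i, ?ii, ?iii, ?iv, ?v, ?vi, ?vii, ?viii, ?ix]")
proof -
  note marked = assms(3)
  let ?N = "lin_span (monomial ` normal_terms M) :: ('n, 'a) polyn set"
  let ?T = "lin_span (term_multiples M \<tau> f)"
  let ?T' = "lin_span (term_multiples M \<tau>' f)"
  let ?B = "lin_span (term_multiples M \<tau>bar f)"
  have le': "\<tau>' \<alpha> \<subseteq> \<tau> \<alpha>" if "\<alpha> \<in> M" for \<alpha>
    using assms(4) that by (auto simp: substructure_def)
  have lebar: "\<tau>bar \<alpha> \<subseteq> \<tau>' \<alpha>" if "\<alpha> \<in> M" for \<alpha>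
    using assms(6) that .
  have cover: "(\<Union>\<alpha>\<in>M. cone \<tau> \<alpha>) = gen_ideal M" "(\<Union>\<alpha>\<in>M. cone \<tau>' \<alpha>) = gen_ideal M"
    using assms(1,4) by (auto simp: substructure_def reduction_structure_def)
  note coverbar = assms(8)
  interpret J: monic_rules "head_rules M \<tau> f" by (rule monic_head_rules[OF marked])
  interpret J': monic_rules "head_rules M \<tau>' f" by (rule monic_head_rules[OF marked])
  interpret Jbar: monic_rules "head_rules M \<tau>bar f" by (rule monic_head_rules[OF marked])
  note down = reduces_down_head_rules[OF marked cover(1)]
    and down' = reduces_down_head_rules[OF marked cover(2)]
    and downbar = reduces_down_head_rules[OF marked coverbar]

  have T'_T: "?T' \<subseteq> ?T" by (intro polyn.span_mono term_multiples_mono le')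
  have B_T': "?B \<subseteq> ?T'" by (intro polyn.span_mono term_multiples_mono lebar)
  have zero: "0 \<in> ?T \<inter> ?N" by (simp add: polyn.span_zero)
  have in_N: "l \<in> ?N" if "reduces_down M \<sigma> f g l" for \<sigma> g l
    using that by (simp add: reduces_down_def lin_span_monomials)
  have diff_T: "g - l \<in> ?T" if "reduces_down M \<tau> f g l" for g l
    using that J.steps_diff_in_span by (simp add: down snd_head_rules)
  have diff_T': "g - l \<in> ?T'" if "reduces_down M \<tau>' f g l" for g l
    using that J'.steps_diff_in_span by (simp add: down' snd_head_rules)
  have diff_B: "g - l \<in> ?B" if "reduces_down M \<tau>bar f g l" for g l
    using that Jbar.steps_diff_in_span by (simp add: downbar snd_head_rules)

  have bar_down': "reduces_down M \<tau>' f g l" if "reduces_down M \<tau>bar f g l" for g l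
    by (rule reduces_down_mono[of M \<tau>bar \<tau>', OF lebar that])
  have down'_down: "reduces_down M \<tau> f g l" if "reduces_down M \<tau>' f g l" for g l
    by (rule reduces_down_mono[of M \<tau>' \<tau>, OF le' that])
  have wf': "wfp (J'.step\<inverse>\<inverse>)"
    using noetherian_imp_wfp[OF assms(5) marked] by (simp add: step_head_rules[OF marked])
  have wfbar: "wfp (Jbar.step\<inverse>\<inverse>)"
  proof (rule wfp_subset[OF wf'])
    show "Jbar.step\<inverse>\<inverse> \<le> J'.step\<inverse>\<inverse>"
      using red_step_mono[of M \<tau>bar \<tau>' f, OF lebar] by (simp add: step_head_rules[OF marked])
  qed
  have nfbar: "\<exists>l. reduces_down M \<tau>bar f g l" for g
    unfolding downbar by (rule Jbar.normal_form_exists[OF wfbar])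
  have nf': "\<exists>l. reduces_down M \<tau>' f g l" for g
    using nfbar bar_down' by blast

  \<comment> \<open>The cones of \<open>\<tau>bar\<close> are disjoint, so its critical pairs are trivial.\<close>
  have unique_rule: "b = b'"
    if "(\<gamma>, b) \<in> head_rules M \<tau>bar f" "(\<gamma>, b') \<in> head_rules M \<tau>bar f" for \<gamma> b b'
  proof -
    from that obtain \<alpha> \<eta> \<alpha>' \<eta>' where
      M: "\<alpha> \<in> M" "\<alpha>' \<in> M" and \<eta>: "\<eta> \<in> \<tau>bar \<alpha>" "\<eta>' \<in> \<tau>bar \<alpha>'"
      and \<gamma>: "\<gamma> = \<alpha> + \<eta>" "\<gamma> = \<alpha>' + \<eta>'"
      and b: "b = monomial \<eta> * f \<alpha>" "b' = monomial \<eta>' * f \<alpha>'"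
      by (auto simp: head_rules_def)
    have "\<gamma> \<in> cone \<tau>bar \<alpha>" "\<gamma> \<in> cone \<tau>bar \<alpha>'"
      using \<eta> \<gamma> unfolding cone_def by blast+
    then have "\<alpha> = \<alpha>'"
      using assms(7) M unfolding disjoint_family_on_def by blast
    with \<gamma> b show ?thesis by simp
  qed
  have Jbar.unique_normal_forms
    using wfbar by (rule Jbar.unique_normal_forms_if_critical_pairs) (use unique_rule in fastforce)
  then have B_N: "n = 0" if "n \<in> ?B" "n \<in> ?N" for n
    using Jbar.normal_in_span_eq_0[of n] that
    by (simp add: snd_head_rules lin_span_monomials Jbar.normal_def fst_head_rules coverbar
        normal_terms_def)

  have iii_T: "n = 0" if ?iii "n \<in> ?T" "n \<in> ?N" for n
    using that by blast

  have i_iii: ?iii if ?i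
  proof -
    have "J.unique_normal_forms"
      using that by (simp add: confluent_def J.unique_normal_forms_def down)
    then have "n = 0" if "n \<in> ?T" "n \<in> ?N" for n
      using J.normal_in_span_eq_0[of n] that
      by (simp add: snd_head_rules lin_span_monomials J.normal_def fst_head_rules cover
          normal_terms_def)
    with zero show ?thesis by blast
  qed
  have iii_i: ?i if ?iii
    unfolding confluent_def
  proof (intro allI ex_ex1I)
    fix g
    show "\<exists>l. reduces_down M \<tau> f g l"
      using nf' down'_down by blast
  next
    fix g l l'
    assume l: "reduces_down M \<tau> f g l" and l': "reduces_down M \<tau> f g l'"
    have "(g - l') - (g - l) \<in> ?T" using diff_T[OF l'] diff_T[OF l] by (rule polyn.span_diff)
    moreover have "l - l' \<in> ?N" using in_N[OF l] in_N[OF l'] by (rule polyn.span_diff)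
    ultimately have "l - l' \<in> ?T" "l - l' \<in> ?N" by simp_all
    with iii_T[OF that, of "l - l'"] show "l = l'" by simp
  qed
  have ii_iii: ?iii if ?ii
    using that by (simp add: direct_sum_is_all_def)
  have iii_ii: ?ii if ?iii
  proof -
    have "\<exists>u\<in>?T. \<exists>w\<in>?N. p = u + w" for p
    proof -
      obtain l where l: "reduces_down M \<tau>bar f p l" using nfbar by blast
      have "p - l \<in> ?T" using diff_B[OF l] B_T' T'_T by blast
      with in_N[OF l] show ?thesis by (metis diff_add_cancel)
    qed
    with that show ?thesis by (simp add: direct_sum_is_all_def)
  qed

  have T_B_iv: ?iv if "?T \<subseteq> ?B"
    using that B_T' T'_T by blast
  have iv_iii: ?iii if ?iv
    using that B_N zero by blast
  have iv_v: ?v if ?iv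
  proof
    fix p
    assume "p \<in> term_multiples M \<tau> f - term_multiples M \<tau>bar f"
    then have p: "p \<in> ?B" using that polyn.span_base by blast
    obtain l where l: "reduces_down M \<tau>bar f p l" using nfbar by blast
    have "p - (p - l) \<in> ?B" using p diff_B[OF l] by (rule polyn.span_diff)
    with B_N[of l] in_N[OF l] l show "reduces_down M \<tau>bar f p 0" by simp
  qed
  have v_iv: ?iv if ?v
  proof (rule T_B_iv)
    have "p \<in> ?B" if "p \<in> term_multiples M \<tau> f" for p
      using that \<open>?v\<close> diff_B[of p 0] polyn.span_base by (cases "p \<in> term_multiples M \<tau>bar f") auto
    then show "?T \<subseteq> ?B" by (intro polyn.span_minimal) auto
  qed

  have iii_viii: ?viii if ?iii
  proof (intro ballI allI impI)
    fix p l
    assume "p \<in> term_multiples M \<tau> f" and l: "reduces_down M \<tau> f p l"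
    then have "p - (p - l) \<in> ?T" by (intro polyn.span_diff diff_T polyn.span_base)
    with iii_T[OF that, of l] in_N[OF l] show "l = 0" by simp
  qed
  have viii_vi: ?vi if ?viii
    using that down'_down by blast
  have vi_v: ?v if ?vi
    using that nfbar bar_down' by (metis DiffD1)

  have multiple: "monomial \<eta> * f \<alpha> \<in> term_multiples M \<sigma> f" if "\<alpha> \<in> M" "\<eta> \<in> \<sigma> \<alpha>" for \<alpha> \<eta> \<sigma>
    using that by (auto simp: term_multiples_def)
  have iii_ix: ?ix if ?iii
  proof (intro ballI allI impI)
    fix \<alpha> \<eta> \<alpha>' \<eta>' l
    let ?p = "monomial \<eta> * f \<alpha> - monomial \<eta>' * f \<alpha>'"
    assume "\<alpha> \<in> M" "\<eta> \<in> \<tau> \<alpha>" "\<alpha>' \<in> M" "\<eta>' \<in> \<tau> \<alpha>'"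
      and l: "reduces_down M \<tau> f ?p l"
    then have "?p - (?p - l) \<in> ?T"
      by (intro polyn.span_diff[OF _ diff_T] polyn.span_diff polyn.span_base multiple)
    with iii_T[OF that, of l] in_N[OF l] show "l = 0" by simp
  qed
  have ix_vii: ?vii if ?ix
  proof (intro ballI impI)
    fix \<alpha> \<eta> \<alpha>' \<eta>'
    let ?p = "monomial \<eta> * f \<alpha> - monomial \<eta>' * f \<alpha>'"
    assume pair: "\<alpha> \<in> M" "\<eta> \<in> \<tau> \<alpha>" "\<alpha>' \<in> M" "\<eta>' \<in> \<tau>' \<alpha>'" "\<eta> + \<alpha> = \<eta>' + \<alpha>'"
    obtain l where l: "reduces_down M \<tau>' f ?p l" using nf' by blast
    have "reduces_down M \<tau> f ?p l" using l by (rule down'_down)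
    with that pair le'[of \<alpha>'] have "l = 0" by blast
    with l show "reduces_down M \<tau>' f ?p 0" by simp
  qed
  have vii_iii: ?iii if ?vii
  proof -
    have crit: "J'.step\<^sup>*\<^sup>* (b' - b) 0"
      if "(\<gamma>, b) \<in> head_rules M \<tau>' f" "(\<gamma>, b') \<in> head_rules M \<tau> f" for \<gamma> b b'
    proof -
      from that obtain \<alpha> \<eta> \<alpha>' \<eta>' where
        "\<alpha> \<in> M" "\<alpha>' \<in> M" "\<eta> \<in> \<tau>' \<alpha>" "\<eta>' \<in> \<tau> \<alpha>'" "\<eta>' + \<alpha>' = \<eta> + \<alpha>"
        and b: "b = monomial \<eta> * f \<alpha>" "b' = monomial \<eta>' * f \<alpha>'"
        by (auto simp: head_rules_def add.commute)
      with \<open>?vii\<close> have "reduces_down M \<tau>' f (b' - b) 0" by blast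
      then show ?thesis by (simp add: down')
    qed
    \<comment> \<open>(vii) with both rules taken from \<open>\<tau>'\<close> is the critical pair condition for \<open>\<tau>'\<close>.\<close>
    have sub: "head_rules M \<tau>' f \<subseteq> head_rules M \<tau> f"
      using le' by (fastforce simp: head_rules_def)
    have J'.unique_normal_forms
      using wf' by (rule J'.unique_normal_forms_if_critical_pairs) (use crit sub in blast)
    then have T'_N: "n = 0" if "n \<in> ?T'" "n \<in> ?N" for n
      using J'.normal_in_span_eq_0[of n] that
      by (simp add: snd_head_rules lin_span_monomials J'.normal_def fst_head_rules cover
          normal_terms_def)
    \<comment> \<open>(vii) with a rule of \<open>\<tau>\<close> and one of \<open>\<tau>'\<close> with the same head gives \<open>\<langle>\<tau>F\<rangle> = \<langle>\<tau>'F\<rangle>\<close>.\<close>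
    have "p \<in> ?T'" if p: "p \<in> term_multiples M \<tau> f" for p
    proof -
      from p obtain \<gamma> where rule: "(\<gamma>, p) \<in> head_rules M \<tau> f"
        by (auto simp flip: snd_head_rules)
      then have "\<gamma> \<in> fst ` head_rules M \<tau> f" by force
      then have "\<gamma> \<in> fst ` head_rules M \<tau>' f" by (simp add: fst_head_rules cover)
      then obtain b where b: "(\<gamma>, b) \<in> head_rules M \<tau>' f" by auto
      then have "b \<in> ?T'" by (intro polyn.span_base) (force simp flip: snd_head_rules)
      moreover have "p - b \<in> ?T'"
        using J'.steps_diff_in_span[OF crit[OF b rule]] by (simp add: snd_head_rules)
      ultimately have "(p - b) + b \<in> ?T'" by (intro polyn.span_add)
      then show ?thesis by simp
    qed
    then have "?T \<subseteq> ?T'" by (intro polyn.span_minimal) auto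
    with T'_N zero show ?thesis by blast
  qed

  have "?i = ?iii" "?ii = ?iii" "?iv = ?iii" "?v = ?iii" "?vi = ?iii" "?vii = ?iii"
    "?viii = ?iii" "?ix = ?iii"
    using i_iii iii_i ii_iii iii_ii iv_iii iv_v v_iv iii_viii viii_vi vi_v iii_ix ix_vii vii_iii
    by argo+
  then show ?thesis by (simp only: all_equivalent_def list.set ball_simps simp_thms)
qed

end
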